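(* Let $d\ge1$ and let $\mu$ be a radial measure on $\mathbb{R}^d$, i.e. $\mu(A)=\int_A\mu_0(\|y\|_2)\,dy$ for a function $\mu_0:(0,\infty)\to[0,\infty)$, not zero almost everywhere, with $\mu_0(t)t^{d-1}$ locally integrable on $(0,\infty)$. Suppose there exists $C>0$ such that for all $x\in\mathbb{R}^d$ and all $r$ with $0<r\le1$, $$\mu\big(B(x\sqrt{1-r^2},\,r\|x\|_2)\big)\le C\,\mu\big(B(x,\,r\|x\|_2)\big).$$ Then for every radial function $f\in L^1(\mathbb{R}^d,d\mu)$ and every $\lambda>0$, $$\lambda\,\mu\{M_\mu f>\lambda\}\le 2(C+1)\|f\|_{L^1(\mathbb{R}^d,d\mu)}.$$
   Context: $\|x\|_2$ is the euclidean norm and $B(x,r)$ the closed euclidean ball of center $x$ and radius $r$. A function $f$ on $\mathbb{R}^d$ is radial if $f(x)=f_0(\|x\|_2)$ for $x\ne0$ for some $f_0:(0,\infty)\to\mathbb{R}$. $M_\mu g(x)=\sup_{\{r>0:\,0<\mu(B(x,r))\}}\frac{1}{\mu(B(x,r))}\int_{B(x,r)}|g|\,d\mu$ is the centered Hardy–Littlewood maximal operator with respect to $\mu$ (with the convention $\infty/\infty=\infty\cdot0=0$). *)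

theory Defs
  imports "HOL-Analysis.Analysis"
begin

definition radial_measure :: "(real \<Rightarrow> real) \<Rightarrow> 'a::euclidean_space measure" where
  "radial_measure mu0 = density lborel (\<lambda>y. ennreal (mu0 (norm y)))"

text \<open>Centered Hardy-Littlewood maximal operator with respect to mu (closed balls),
  with values in [0,\<infinity>]; in ennreal, a / \<infinity> = 0, matching the convention.\<close>
definition maximal_op :: "'a::metric_space measure \<Rightarrow> ('a \<Rightarrow> real) \<Rightarrow> 'a \<Rightarrow> ennreal" where
  "maximal_op mu g x =
     (SUP r \<in> {r. r > 0 \<and> 0 < emeasure mu (cball x r)}.
        (\<integral>\<^sup>+ y \<in> cball x r. ennreal \<bar>g y\<bar> \<partial>mu) / emeasure mu (cball x r))"

text \<open>Outer measure (so that the level set need not be assumed measurable).\<close>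
definition outer_meas :: "'a measure \<Rightarrow> 'a set \<Rightarrow> ennreal" where
  "outer_meas mu S = (INF A \<in> {A \<in> sets mu. S \<subseteq> A}. emeasure mu A)"

definition radial_fun :: "('a::real_normed_vector \<Rightarrow> real) \<Rightarrow> bool" where
  "radial_fun f \<longleftrightarrow> (\<exists>f0. \<forall>x. x \<noteq> 0 \<longrightarrow> f x = f0 (norm x))"

end

theory Submission
  imports Defs
begin

text \<open>
  In polar coordinates \<open>mu\<close> is a product of a measure \<open>nu\<close> on the half line and the surface measure, and
  \<open>\<bar>f\<bar>\<close> depends on the radius only. Fix \<open>x \<noteq> 0\<close> and a ball \<open>B(x, r \<bar>x\<bar>)\<close> over which the average
  of \<open>\<bar>f\<bar>\<close> exceeds \<open>lam\<close>. Rays meet this ball in intervals which need not contain the radius \<open>\<bar>x\<bar>\<close>.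
  If \<open>r \<le> 1\<close>, add the ball \<open>B(x sqrt (1 - r^2), r \<bar>x\<bar>)\<close>, restricted to the cone spanned by the first ball;
  if \<open>r > 1\<close>, add \<open>B(0, \<bar>x\<bar>)\<close>. The enlarged set \<open>B\<close> has at most \<open>C + 1\<close> times the mass, and every ray
  that meets it does so in an interval containing \<open>\<bar>x\<bar>\<close>. Integrating over directions, one of these
  intervals has a \<open>nu\<close>-average exceeding \<open>lam / (C + 1)\<close>. So \<open>\<bar>x\<bar>\<close> lies in a level set of the
  uncentered maximal function on the line with respect to \<open>nu\<close>, which satisfies the weak type
  inequality with constant 2 because a finite cover by intervals can be thinned out until no point is
  covered more than twice.
\<close>

subsection \<open>Polar coordinates\<close>

lemma measure_eqI_atMost:
  fixes M N :: "real measure"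
  assumes sets: "sets M = sets borel" "sets N = sets borel"
    and fin: "\<And>a. emeasure M {..a} < \<infinity>"
    and eq: "\<And>a. emeasure M {..a} = emeasure N {..a}"
  shows "M = N"
proof (rule measure_eqI_generator_eq_countable)
  let ?E = "range (\<lambda>a::real. {..a})"
  show "Int_stable ?E" by (auto simp: Int_stable_def)
  show "?E \<subseteq> Pow UNIV" "sets M = sigma_sets UNIV ?E" "sets N = sigma_sets UNIV ?E"
    unfolding sets borel_eq_atMost by auto
  show "(\<lambda>n. {..real n}) ` UNIV \<subseteq> ?E" "(\<Union>n. {..real n}) = UNIV"
    by (auto intro: real_arch_simple)
  show "\<And>A. A \<in> (\<lambda>n. {..real n}) ` UNIV \<Longrightarrow> emeasure M A \<noteq> \<infinity>"
    using fin by (auto simp: less_top)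
qed (auto intro: eq)

text \<open>Both measures are left unnormalised: the total mass of \<open>sphere_measure\<close> is the volume of
  the unit ball, and \<open>radial_lborel n\<close> gives the interval from \<open>0\<close> to \<open>a\<close> the mass \<open>a ^ n\<close>.\<close>

definition sphere_measure :: "'a::euclidean_space measure" where
  "sphere_measure = distr (density lborel (indicator (cball 0 1))) borel sgn"

definition radial_lborel :: "nat \<Rightarrow> real measure" where
  "radial_lborel n = density lborel (\<lambda>t. ennreal (real n * t ^ (n - 1)) * indicator {0<..} t)"

lemma sets_sphere_measure [simp, measurable_cong]: "sets sphere_measure = sets borel"
  by (simp add: sphere_measure_def)

lemma space_sphere_measure [simp]: "space sphere_measure = UNIV"
  by (simp add: sphere_measure_def)

lemma sets_radial_lborel [simp, measurable_cong]: "sets (radial_lborel n) = sets borel"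
  by (simp add: radial_lborel_def)

lemma space_radial_lborel [simp]: "space (radial_lborel n) = UNIV"
  by (simp add: radial_lborel_def)

lemma borel_measurable_sgn [measurable]: "(sgn :: 'a::euclidean_space \<Rightarrow> 'a) \<in> borel_measurable borel"
  unfolding sgn_div_norm[abs_def] by measurable

lemma emeasure_sphere_measure:
  assumes [measurable]: "E \<in> sets borel"
  shows "emeasure sphere_measure (E :: 'a::euclidean_space set) = emeasure lborel (cball 0 1 \<inter> sgn -` E)"
proof -
  have "emeasure sphere_measure E = emeasure (density lborel (indicator (cball 0 1))) (sgn -` E)"
    unfolding sphere_measure_def by (subst emeasure_distr) (auto simp: space_density)
  also have "\<dots> = emeasure lborel (cball 0 1 \<inter> sgn -` E)"
    using measurable_sets[OF borel_measurable_sgn, of E]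
    by (subst emeasure_density)
       (auto simp: indicator_inter_arith[symmetric] intro!: nn_integral_indicator borel_measurable_indicator borel_closed)
  finally show ?thesis .
qed

lemma emeasure_sphere_measure_UNIV:
  "emeasure (sphere_measure :: 'a::euclidean_space measure) UNIV < \<infinity>"
  using emeasure_lborel_cball_finite[of "0::'a" 1] by (subst emeasure_sphere_measure) auto

lemma finite_measure_sphere_measure: "finite_measure sphere_measure"
  using emeasure_sphere_measure_UNIV by (intro finite_measureI) (auto simp: less_top)

lemma sigma_finite_radial_lborel: "sigma_finite_measure (radial_lborel n)"
  unfolding radial_lborel_def
  by (subst sigma_finite_measure.sigma_finite_iff_density_finite[OF sigma_finite_lborel])
     (auto simp: ennreal_mult_eq_top_iff split: split_indicator)

lemma emeasure_radial_lborel_atMost: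
  assumes n: "n > 0"
  shows "emeasure (radial_lborel n) {..a} = ennreal (max 0 a ^ n)"
proof (cases "a > 0")
  case True
  have "emeasure (radial_lborel n) {..a} =
      (\<integral>\<^sup>+ t. ennreal (real n * t ^ (n - 1)) * indicator {0<..} t * indicator {..a} t \<partial>lborel)"
    unfolding radial_lborel_def by (subst emeasure_density) auto
  also have "\<dots> = (\<integral>\<^sup>+ t. ennreal (real n * t ^ (n - 1)) * indicator {0..a} t \<partial>lborel)"
  \<comment> \<open>The fundamental theorem is applied on a closed interval, while the density
    vanishes at \<open>0\<close>; the two integrands differ only at that null point.\<close>
  proof (rule nn_integral_cong_AE)
    show "AE t in lborel. ennreal (real n * t ^ (n - 1)) * indicator {0<..} t * indicator {..a} t
        = ennreal (real n * t ^ (n - 1)) * indicator {0..a} t"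
      using AE_lborel_singleton[of 0] by eventually_elim (auto split: split_indicator)
  qed
  also have "\<dots> = ennreal (a ^ n - 0 ^ n)"
    using True by (intro nn_integral_FTC_Icc) (auto intro!: derivative_eq_intros)
  finally show ?thesis using True n by simp
next
  case False
  then have "emeasure (radial_lborel n) {..a} =
      (\<integral>\<^sup>+ t. ennreal (real n * t ^ (n - 1)) * indicator {0<..} t * indicator {..a} t \<partial>lborel)"
    unfolding radial_lborel_def by (subst emeasure_density) auto
  also have "\<dots> = (\<integral>\<^sup>+ (t::real). 0 \<partial>lborel)"
    using False by (intro nn_integral_cong) (auto split: split_indicator)
  finally show ?thesis using False n by (simp add: max_absorb1)
qed

text \<open>\<open>sgn\<close> is invariant under positive dilations, so the cone over
  \<open>E\<close> inside radius \<open>a\<close> is the dilate by \<open>a\<close> of the cone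
  inside radius \<open>1\<close>, and Lebesgue measure scales with the power
  \<open>DIM('a)\<close>.\<close>

lemma emeasure_lborel_scaled_cone:
  fixes E :: "'a::euclidean_space set"
  assumes [measurable]: "E \<in> sets borel" and a: "a > 0"
  shows "emeasure lborel (cball 0 a \<inter> sgn -` E) = ennreal (a ^ DIM('a)) * emeasure sphere_measure E"
proof -
  have [measurable]: "sgn -` E \<in> sets borel"
    using measurable_sets[OF borel_measurable_sgn, of E] by auto
  have "emeasure lborel (cball 0 a \<inter> sgn -` E) =
    emeasure (density (distr lborel borel (\<lambda>x::'a. 0 + a *\<^sub>R x)) (\<lambda>_. \<bar>a\<bar>^DIM('a))) (cball 0 a \<inter> sgn -` E)"
    using a by (subst lborel_affine[of a 0]) auto
  also have "\<dots> = ennreal (\<bar>a\<bar>^DIM('a)) * emeasure lborel ((\<lambda>x. a *\<^sub>R x) -` (cball 0 a \<inter> sgn -` E))"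
    by (subst emeasure_density_const) (auto simp: emeasure_distr)
  also have "(\<lambda>x. a *\<^sub>R x) -` (cball 0 a \<inter> sgn -` E) = cball 0 1 \<inter> sgn -` E"
    using a by (auto simp: sgn_scaleR mult_le_cancel_left1)
  finally show ?thesis using a by (simp add: emeasure_sphere_measure)
qed

text \<open>For fixed \<open>E\<close> both sides are measures in \<open>A\<close>. They are finite
  and agree on the half lines \<open>{..a}\<close>, by the scaling of cones, and such half lines
  determine a measure.\<close>

lemma emeasure_lborel_polar_rectangle:
  fixes E :: "'a::euclidean_space set"
  assumes [measurable]: "E \<in> sets borel" "A \<in> sets borel"
  shows "emeasure lborel (sgn -` E \<inter> norm -` A) =
    emeasure sphere_measure E * emeasure (radial_lborel DIM('a)) A"
proof -
  let ?M = "distr (density lborel (indicator (sgn -` E))) borel (norm :: 'a \<Rightarrow> real)"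
  let ?N = "density (radial_lborel DIM('a)) (\<lambda>_. emeasure sphere_measure E)"
  have [measurable]: "sgn -` E \<in> sets borel"
    using measurable_sets[OF borel_measurable_sgn, of E] by auto
  have fin: "emeasure sphere_measure E < \<infinity>"
    by (rule order_le_less_trans[OF emeasure_mono emeasure_sphere_measure_UNIV]) auto
  have M: "emeasure ?M B = emeasure lborel (sgn -` E \<inter> norm -` B)" if [measurable]: "B \<in> sets borel" for B
  proof -
    have [measurable]: "norm -` B \<in> sets (borel :: 'a measure)"
      using measurable_sets[of "norm :: 'a \<Rightarrow> real" borel borel B] by auto
    show ?thesis
      by (subst emeasure_distr, simp, simp, subst emeasure_density)
         (auto simp: indicator_inter_arith[symmetric] intro!: nn_integral_indicator)
  qed
  have N: "emeasure ?N B = emeasure sphere_measure E * emeasure (radial_lborel DIM('a)) B"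
    if "B \<in> sets borel" for B
    using that by (subst emeasure_density_const) auto
  have eq: "emeasure ?M {..a} = emeasure ?N {..a}" for a
  proof (cases "a > 0")
    case True
    have "sgn -` E \<inter> norm -` {..a} = cball 0 a \<inter> sgn -` E" by auto
    then show ?thesis using True
      by (simp add: M N emeasure_lborel_scaled_cone emeasure_radial_lborel_atMost mult.commute)
  next
    case False
    \<comment> \<open>For \<open>a\<close> not positive, at most the origin has norm in
      \<open>{..a}\<close>.\<close>
    have "emeasure lborel (sgn -` E \<inter> norm -` {..a}) \<le> emeasure lborel {0::'a}"
      using False by (intro emeasure_mono) (auto intro: order_trans simp: not_less simp flip: norm_le_zero_iff)
    with False show ?thesis
      by (simp add: M N emeasure_radial_lborel_atMost max_absorb1 emeasure_lborel_singleton)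
  qed
  have "emeasure ?M {..a} < \<infinity>" for a
    unfolding eq by (subst N) (auto simp: emeasure_radial_lborel_atMost ennreal_mult_less_top fin[simplified])
  then have "?M = ?N"
    using eq by (intro measure_eqI_atMost) auto
  then show ?thesis
    using M[of A] N[of A] by simp
qed

text \<open>The values on rectangles determine the product measure, so it is the image of Lebesgue
  measure under \<open>y\<close> \<mapsto> \<open>(sgn y, norm y)\<close>. The formula is then a
  change of variables followed by Tonelli.\<close>

lemma nn_integral_polar:
  fixes h :: "'a::euclidean_space \<Rightarrow> ennreal"
  assumes [measurable]: "h \<in> borel_measurable borel"
  shows "(\<integral>\<^sup>+ y. h y \<partial>lborel) =
    (\<integral>\<^sup>+ w. \<integral>\<^sup>+ t. h (t *\<^sub>R w) \<partial>radial_lborel DIM('a) \<partial>sphere_measure)"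
proof -
  interpret S: finite_measure "sphere_measure :: 'a measure" by (rule finite_measure_sphere_measure)
  interpret R: sigma_finite_measure "radial_lborel DIM('a)" by (rule sigma_finite_radial_lborel)
  have [measurable]: "(\<lambda>y::'a. (sgn y, norm y)) \<in> lborel \<rightarrow>\<^sub>M borel \<Otimes>\<^sub>M borel" by measurable
  have sets: "sets (sphere_measure \<Otimes>\<^sub>M radial_lborel DIM('a)) =
      sets ((borel :: 'a measure) \<Otimes>\<^sub>M (borel :: real measure))"
    by (intro sets_pair_measure_cong) auto
  have "sphere_measure \<Otimes>\<^sub>M radial_lborel DIM('a) =
      distr lborel (borel \<Otimes>\<^sub>M borel) (\<lambda>y::'a. (sgn y, norm y))"
  proof (rule pair_measure_eqI)
    fix E :: "'a set" and A assume "E \<in> sets sphere_measure" "A \<in> sets (radial_lborel DIM('a))"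
    then have [measurable]: "E \<in> sets borel" "A \<in> sets borel" by auto
    have "(\<lambda>y::'a. (sgn y, norm y)) -` (E \<times> A) = sgn -` E \<inter> norm -` A" by auto
    then show "emeasure sphere_measure E * emeasure (radial_lborel DIM('a)) A =
        emeasure (distr lborel (borel \<Otimes>\<^sub>M borel) (\<lambda>y::'a. (sgn y, norm y))) (E \<times> A)"
      by (subst emeasure_distr) (auto simp: emeasure_lborel_polar_rectangle)
  qed (use sets in \<open>auto intro: S.sigma_finite_measure_axioms R.sigma_finite_measure_axioms\<close>)
  note polar = this
  have hm [measurable]: "(\<lambda>(w, t). h (t *\<^sub>R w)) \<in> borel_measurable ((borel :: 'a measure) \<Otimes>\<^sub>M (borel :: real measure))"
    by measurable
  have "(\<integral>\<^sup>+ w. \<integral>\<^sup>+ t. h (t *\<^sub>R w) \<partial>radial_lborel DIM('a) \<partial>sphere_measure) =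
      (\<integral>\<^sup>+ p. (\<lambda>(w, t). h (t *\<^sub>R w)) p \<partial>(sphere_measure \<Otimes>\<^sub>M radial_lborel DIM('a)))"
    using R.nn_integral_fst[of "\<lambda>(w, t). h (t *\<^sub>R w)" sphere_measure] hm
    by (simp add: measurable_cong_sets[OF sets refl])
  also have "\<dots> = (\<integral>\<^sup>+ y. h (norm y *\<^sub>R sgn y) \<partial>lborel)"
    unfolding polar by (subst nn_integral_distr) auto
  also have "\<dots> = (\<integral>\<^sup>+ y. h y \<partial>lborel)"
  proof (rule nn_integral_cong)
    fix y :: 'a
    have "norm y *\<^sub>R sgn y = y" by (cases "y = 0") (auto simp: sgn_div_norm)
    then show "h (norm y *\<^sub>R sgn y) = h y" by simp
  qed
  finally show ?thesis by simp
qed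

text \<open>\<open>sphere_measure\<close> is a measure on the whole space. As
  \<open>sgn 0 = 0\<close>, the origin is the only point that \<open>sgn\<close> does not send to
  the unit sphere, and it is a null set.\<close>

lemma AE_sphere_measure: "AE w in (sphere_measure :: 'a::euclidean_space measure). norm w = 1"
proof -
  have "AE y in (lborel :: 'a measure). norm (sgn y) = 1"
    using AE_lborel_singleton[of "0::'a"] by eventually_elim (auto simp: norm_sgn)
  then have "AE y in density lborel (indicator (cball (0::'a) 1)). norm (sgn y) = 1"
    by (subst AE_density) (auto intro!: borel_measurable_indicator borel_closed elim: eventually_mono)
  then show ?thesis
    unfolding sphere_measure_def by (subst AE_distr_iff) auto
qed

lemma AE_radial_lborel: "AE t in radial_lborel n. t > 0"
  unfolding radial_lborel_def by (subst AE_density) (auto split: split_indicator)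

subsection \<open>The uncentered maximal inequality on the line\<close>

text \<open>A subfamily of least cardinality with the same union works: among the members through a
  point \<open>t\<close>, the one starting furthest left and the one ending furthest right cover all
  others, so a third member would be redundant.\<close>

lemma interval_subcover:
  fixes P :: "(real \<times> real) set"
  assumes "finite P"
  obtains Q where "Q \<subseteq> P" "(\<Union>(a, b)\<in>Q. {a<..<b}) = (\<Union>(a, b)\<in>P. {a<..<b})"
    "\<And>t. card {q\<in>Q. t \<in> {fst q<..<snd q}} \<le> 2"
proof -
  let ?U = "\<lambda>Q. \<Union>(a::real, b)\<in>Q. {a<..<b}"
  define Q where "Q = arg_min card (\<lambda>Q. Q \<subseteq> P \<and> ?U Q = ?U P)"
  have "Q \<subseteq> P \<and> ?U Q = ?U P"
    unfolding Q_def using arg_min_nat_lemma[of "\<lambda>Q. Q \<subseteq> P \<and> ?U Q = ?U P" P card] by blast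
  then have Q: "Q \<subseteq> P" "?U Q = ?U P" by auto
  have minim: "card Q \<le> card Q'" if "Q' \<subseteq> P" "?U Q' = ?U P" for Q'
    unfolding Q_def using that by (intro arg_min_nat_le) auto
  have finQ: "finite Q" using finite_subset[OF Q(1) assms] .
  have "card {q\<in>Q. t \<in> {fst q<..<snd q}} \<le> 2" for t
  proof (cases "{q\<in>Q. t \<in> {fst q<..<snd q}} = {}")
    case False
    define T where "T = {q\<in>Q. t \<in> {fst q<..<snd q}}"
    have T: "finite T" "T \<noteq> {}" "T \<subseteq> Q"
      using False finite_subset[OF _ finQ, of T] unfolding T_def by blast+
    obtain p where "p \<in> T" "Min (fst ` T) = fst p"
      using T(1,2) by (rule obtains_MIN)
    then have p: "p \<in> T" "fst p \<le> fst r" if "r \<in> T" for r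
      using Min_le[of "fst ` T" "fst r"] T that by auto
    obtain q where "q \<in> T" "Max (snd ` T) = snd q"
      using T(1,2) by (rule obtains_MAX)
    then have q: "q \<in> T" "snd r \<le> snd q" if "r \<in> T" for r
      using Max_ge[of "snd ` T" "snd r"] T that by auto
    have "T \<subseteq> {p, q}"
    proof
      fix r assume r: "r \<in> T"
      show "r \<in> {p, q}"
      proof (rule ccontr)
        assume n: "r \<notin> {p, q}"
        \<comment> \<open>\<open>p\<close> starts no later than \<open>r\<close>, \<open>q\<close>
          ends no earlier, and \<open>p\<close> and \<open>q\<close> overlap at \<open>t\<close>, so
          there is no gap between them.\<close>
        have "{fst r<..<snd r} \<subseteq> {fst p<..<snd p} \<union> {fst q<..<snd q}"
          using p[OF r] q[OF r] r by (auto simp: T_def)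
        moreover have "p \<in> Q - {r}" "q \<in> Q - {r}" using n p[OF r] q[OF r] T by auto
        ultimately have "{fst r<..<snd r} \<subseteq> ?U (Q - {r})"
          unfolding case_prod_beta by blast
        then have "?U Q \<subseteq> ?U (Q - {r})"
          unfolding case_prod_beta by blast
        then have "?U (Q - {r}) = ?U Q" by blast
        then have "card Q \<le> card (Q - {r})"
          using Q by (intro minim) auto
        moreover have "card (Q - {r}) < card Q"
          using r T finQ by (intro card_Diff1_less) auto
        ultimately show False by simp
      qed
    qed
    then have "card T \<le> card {p, q}" by (intro card_mono) auto
    also have "\<dots> \<le> 2" by (simp add: card_insert_if)
    finally show ?thesis by (simp add: T_def)
  next
    case True
    show ?thesis unfolding True by simp
  qed
  with Q that show ?thesis by blast
qed

text \<open>For a finite family, pass to a subcover of multiplicity at most two and sum the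
  hypotheses: the right side counts every point at most twice, which gives the constant 2. The
  general case is a limit of finite ones.\<close>

lemma weak_type_intervals:
  fixes nu :: "real measure" and G :: "real \<Rightarrow> ennreal" and c :: ennreal
  assumes sets [measurable_cong, simp]: "sets nu = sets borel"
    and G [measurable]: "G \<in> borel_measurable borel"
    and P: "\<And>a b. (a, b) \<in> P \<Longrightarrow> c * emeasure nu {a<..<b} \<le> (\<integral>\<^sup>+ t\<in>{a<..<b}. G t \<partial>nu)"
  shows "c * emeasure nu (\<Union>(a, b)\<in>P. {a<..<b}) \<le> 2 * (\<integral>\<^sup>+ t. G t \<partial>nu)"
proof -
  let ?U = "\<lambda>Q. \<Union>(a::real, b)\<in>Q. {a<..<b}"
  have fin: "c * emeasure nu (?U Q) \<le> 2 * (\<integral>\<^sup>+ t. G t \<partial>nu)" if Q: "finite Q" "Q \<subseteq> P" for Q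
  proof -
    obtain R where R: "R \<subseteq> Q" "?U R = ?U Q" "\<And>t. card {q\<in>R. t \<in> {fst q<..<snd q}} \<le> 2"
      using interval_subcover[OF Q(1)] by blast
    have finR: "finite R" using finite_subset[OF R(1) Q(1)] .
    have "c * emeasure nu (?U Q) = c * emeasure nu (?U R)" by (simp add: R(2))
    also have "\<dots> \<le> c * (\<Sum>p\<in>R. emeasure nu (case p of (a, b) \<Rightarrow> {a<..<b}))"
      by (intro mult_left_mono emeasure_subadditive_finite finR) auto
    also have "\<dots> = (\<Sum>p\<in>R. c * emeasure nu {fst p<..<snd p})"
      by (simp add: sum_distrib_left case_prod_beta)
    also have "\<dots> \<le> (\<Sum>p\<in>R. \<integral>\<^sup>+ t\<in>{fst p<..<snd p}. G t \<partial>nu)"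
      using R(1) Q(2) by (intro sum_mono P) auto
    also have "\<dots> = (\<integral>\<^sup>+ t. (\<Sum>p\<in>R. G t * indicator {fst p<..<snd p} t) \<partial>nu)"
      by (subst nn_integral_sum) auto
    also have "\<dots> \<le> (\<integral>\<^sup>+ t. 2 * G t \<partial>nu)"
    proof (rule nn_integral_mono)
      fix t
      have "(\<Sum>p\<in>R. G t * indicator {fst p<..<snd p} t) =
          G t * (\<Sum>p\<in>R. if t \<in> {fst p<..<snd p} then 1 else 0)"
        unfolding sum_distrib_left by (intro sum.cong) (auto split: split_indicator)
      also have "\<dots> = G t * of_nat (card {q\<in>R. t \<in> {fst q<..<snd q}})"
        using finR by (simp add: sum.If_cases Int_def)
      also have "\<dots> \<le> G t * of_nat 2"
        by (intro mult_left_mono of_nat_mono R(3)) auto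
      finally show "(\<Sum>p\<in>R. G t * indicator {fst p<..<snd p} t) \<le> 2 * G t"
        by (simp add: mult.commute)
    qed
    also have "\<dots> = 2 * (\<integral>\<^sup>+ t. G t \<partial>nu)" by (intro nn_integral_cmult) auto
    finally show ?thesis .
  qed
  \<comment> \<open>\<open>P\<close> may be uncountable. Since the intervals are open, countably
    many have the same union, and continuity from below along an enumeration applies.\<close>
  obtain F where F: "F \<subseteq> (\<lambda>(a, b). {a<..<b}) ` P" "countable F" "\<Union>F = ?U P"
  proof (rule Lindelof[of "(\<lambda>(a, b). {a<..<b}) ` P"])
    show "open S" if "S \<in> (\<lambda>(a, b). {a<..<b}) ` P" for S :: "real set"
      using that by auto
  qed
  obtain P' where P': "P' \<subseteq> P" "countable P'" "F = (\<lambda>(a, b). {a<..<b}) ` P'"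
    using F by (metis countable_subset_image)
  then have UP: "?U P' = ?U P" using F by simp
  show ?thesis
  proof (cases "P' = {}")
    case True
    then show ?thesis unfolding UP[symmetric] by simp
  next
    case False
    define e where "e = from_nat_into P'"
    have re: "range e = P'" unfolding e_def using False P' by (simp add: range_from_nat_into)
    let ?A = "\<lambda>n. ?U (e ` {..<n})"
    have inc: "incseq ?A" by (intro incseq_SucI) (auto simp: less_Suc_eq)
    have meas: "(\<Union>p\<in>I. case p of (a, b) \<Rightarrow> {a<..<b}) \<in> sets borel" for I :: "(real \<times> real) set"
      by (intro borel_open open_UN) auto
    have "e ` (\<Union>n. {..<n}) = P'"
      using re by (simp add: UN_lessThan_UNIV)
    then have U: "(\<Union>n. ?A n) = ?U P'"
      by (metis UN_UN_flatten image_UN)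
    have "c * emeasure nu (?U P') = (SUP n. c * emeasure nu (?A n))"
      unfolding U[symmetric] SUP_mult_left_ennreal[symmetric]
      by (subst SUP_emeasure_incseq[OF _ inc]) (use meas in \<open>simp_all only: sets image_subset_iff Ball_def simp_thms\<close>)
    also have "\<dots> \<le> 2 * (\<integral>\<^sup>+ t. G t \<partial>nu)"
      using re P' by (intro SUP_least fin) auto
    finally show ?thesis by (simp add: UP)
  qed
qed

text \<open>The intervals found on rays are closed and may have the given radius as an endpoint,
  while the covering argument uses open ones. Open intervals shrinking to \<open>{a..b}\<close> have
  masses tending to that of \<open>{a..b}\<close>, and the integral of \<open>G\<close> only grows
  under enlargement, so the strict inequality survives.\<close>

lemma enlarge_interval:
  fixes nu :: "real measure" and G :: "real \<Rightarrow> ennreal" and c :: ennreal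
  assumes sets [measurable_cong, simp]: "sets nu = sets borel"
    and c: "c < \<infinity>"
    and "p < a" "b < q" and fin: "emeasure nu {p<..<q} < \<infinity>"
    and less: "c * emeasure nu {a..b} < (\<integral>\<^sup>+ t\<in>{a..b}. G t \<partial>nu)"
  shows "\<exists>a'<a. \<exists>b'>b. c * emeasure nu {a'<..<b'} < (\<integral>\<^sup>+ t\<in>{a'<..<b'}. G t \<partial>nu)"
proof -
  \<comment> \<open>Clipping to \<open>{p<..<q}\<close> keeps every mass finite, which continuity
    from above requires.\<close>
  define A where "A n = {max p (a - inverse (real (Suc n)))<..<min q (b + inverse (real (Suc n)))}" for n
  have I: "inverse (real (Suc n)) \<ge> inverse (real (Suc m))" if "n \<le> m" for n m
    using that by (intro le_imp_inverse_le) auto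
  have dec: "decseq A"
    unfolding decseq_def A_def
  proof (intro allI impI subsetI)
    fix m n :: nat and x assume "m \<le> n" and "x \<in> {max p (a - inverse (real (Suc n)))<..<min q (b + inverse (real (Suc n)))}"
    then show "x \<in> {max p (a - inverse (real (Suc m)))<..<min q (b + inverse (real (Suc m)))}"
      using I[OF \<open>m \<le> n\<close>] unfolding greaterThanLessThan_iff max_less_iff_conj min_less_iff_conj by linarith
  qed
  have finA: "emeasure nu (A n) \<noteq> \<infinity>" for n
  proof -
    have "emeasure nu (A n) \<le> emeasure nu {p<..<q}"
      by (intro emeasure_mono) (auto simp: A_def)
    with fin show ?thesis by (auto simp: top_unique)
  qed
  have int: "(\<Inter>n. A n) = {a..b}"
  proof safe
    fix x assume x: "x \<in> (\<Inter>n. A n)"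
    have "a \<le> x"
    proof (rule ccontr)
      assume "\<not> a \<le> x"
      then obtain n where "inverse (real (Suc n)) < a - x" using reals_Archimedean[of "a - x"] by auto
      then show False using x by (auto simp: A_def dest!: spec[of _ n])
    qed
    moreover have "x \<le> b"
    proof (rule ccontr)
      assume "\<not> x \<le> b"
      then obtain n where "inverse (real (Suc n)) < x - b" using reals_Archimedean[of "x - b"] by auto
      then show False using x by (auto simp: A_def dest!: spec[of _ n])
    qed
    ultimately show "x \<in> {a..b}" by simp
  next
    fix x n assume "x \<in> {a..b}"
    moreover have "inverse (real (Suc n)) > 0" by simp
    ultimately show "x \<in> A n" using assms(3,4)
      unfolding A_def greaterThanLessThan_iff max_less_iff_conj min_less_iff_conj atLeastAtMost_iff by linarith
  qed
  have "(\<lambda>n. c * emeasure nu (A n)) \<longlonglongrightarrow> c * emeasure nu (\<Inter>n. A n)"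
    by (intro ennreal_tendsto_cmult Lim_emeasure_decseq dec finA) (use c in \<open>auto simp: A_def\<close>)
  then have "eventually (\<lambda>n. c * emeasure nu (A n) < (\<integral>\<^sup>+ t\<in>{a..b}. G t \<partial>nu)) sequentially"
    using less unfolding int by (rule order_tendstoD)
  then obtain n where n: "c * emeasure nu (A n) < (\<integral>\<^sup>+ t\<in>{a..b}. G t \<partial>nu)"
    by (auto simp: eventually_sequentially)
  have "(\<integral>\<^sup>+ t\<in>{a..b}. G t \<partial>nu) \<le> (\<integral>\<^sup>+ t\<in>A n. G t \<partial>nu)"
    unfolding int[symmetric] by (intro nn_integral_mono) (auto split: split_indicator)
  with n have "c * emeasure nu (A n) < (\<integral>\<^sup>+ t\<in>A n. G t \<partial>nu)" by simp
  moreover have "inverse (real (Suc n)) > 0" by simp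
  then have "max p (a - inverse (real (Suc n))) < a" "b < min q (b + inverse (real (Suc n)))"
    using assms(3,4) by linarith+
  ultimately show ?thesis unfolding A_def by blast
qed

subsection \<open>Ray sections of balls\<close>

text \<open>The parameters form a compact convex subset of the line, hence a closed interval. A line
  that misses the ball is the case \<open>u < l\<close>.\<close>

lemma cball_ray_section:
  fixes z w :: "'a::euclidean_space"
  assumes w: "norm w = 1"
  obtains l u where "{t. t *\<^sub>R w \<in> cball z \<rho>} = {l..u}"
proof -
  let ?S = "{t. t *\<^sub>R w \<in> cball z \<rho>}"
  have S: "?S = (\<lambda>t. t *\<^sub>R w) -` cball z \<rho>" by auto
  have "convex ?S"
    unfolding S by (intro convex_linear_vimage) (auto intro!: linear_scaleR_left bounded_linear.linear[OF bounded_linear_scaleR_left])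
  moreover have "closed ?S"
    unfolding S by (intro closed_vimage) (auto intro!: continuous_intros)
  moreover have "bounded ?S"
  proof (rule boundedI)
    fix t assume "t \<in> ?S"
    then show "norm t \<le> norm z + \<rho>"
      using w norm_triangle_ineq3[of "t *\<^sub>R w" z] by (auto simp: dist_norm norm_minus_commute)
  qed
  ultimately have "connected ?S \<and> compact ?S"
    by (auto simp: compact_eq_bounded_closed convex_connected)
  then show ?thesis using that unfolding connected_compact_interval_1 by auto
qed

text \<open>Two intervals with the common point \<open>t0\<close> have an interval as union, and the
  second one already contains \<open>s\<close>.\<close>

lemma two_cballs_ray_section:
  fixes z1 z2 w :: "'a::euclidean_space"
  assumes w: "norm w = 1" and "0 \<le> t0" "0 < s"
    and "t0 *\<^sub>R w \<in> cball z1 \<rho>1" "t0 *\<^sub>R w \<in> cball z2 \<rho>2" "s *\<^sub>R w \<in> cball z2 \<rho>2"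
  shows "\<exists>a b. 0 \<le> a \<and> a \<le> s \<and> s \<le> b \<and>
    (\<forall>t>0. t *\<^sub>R w \<in> cball z1 \<rho>1 \<union> cball z2 \<rho>2 \<longleftrightarrow> a \<le> t \<and> t \<le> b)"
proof -
  obtain l1 u1 where 1: "{t. t *\<^sub>R w \<in> cball z1 \<rho>1} = {l1..u1}" using cball_ray_section[OF w] .
  obtain l2 u2 where 2: "{t. t *\<^sub>R w \<in> cball z2 \<rho>2} = {l2..u2}" using cball_ray_section[OF w] .
  have i: "t *\<^sub>R w \<in> cball z1 \<rho>1 \<longleftrightarrow> l1 \<le> t \<and> t \<le> u1" "t *\<^sub>R w \<in> cball z2 \<rho>2 \<longleftrightarrow> l2 \<le> t \<and> t \<le> u2" for t
    using 1 2 by (auto simp: set_eq_iff simp del: mem_cball)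
  have "l1 \<le> t0" "t0 \<le> u1" "l2 \<le> t0" "t0 \<le> u2" "l2 \<le> s" "s \<le> u2"
    using assms i by blast+
  then show ?thesis using assms(2,3)
    \<comment> \<open>Only positive \<open>t\<close> are tested, so the left end can be raised to
      \<open>0\<close>.\<close>
    by (intro exI[of _ "max 0 (min l1 l2)"] exI[of _ "max u1 u2"]) (auto simp: i simp del: mem_cball)
qed

text \<open>The cone is the one spanned by \<open>cball x (r * norm x)\<close>. It touches that ball along the
  sphere of radius \<open>k * norm x\<close>, and every ray in the cone meets both balls at that radius.\<close>

lemma cball_subset_cone:
  fixes x :: "'a::euclidean_space"
  assumes r: "0 < r" "r \<le> 1" and k: "k = sqrt (1 - r\<^sup>2)" and y: "y \<in> cball x (r * norm x)"
  shows "k * norm x * norm y \<le> x \<bullet> y"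
proof -
  have k2: "k\<^sup>2 = 1 - r\<^sup>2" using r by (simp add: k power_le_one)
  have "(norm (x - y))\<^sup>2 \<le> (r * norm x)\<^sup>2"
    using y by (intro power_mono) (auto simp: dist_norm)
  then have "(norm x)\<^sup>2 - 2 * (x \<bullet> y) + (norm y)\<^sup>2 \<le> (1 - k\<^sup>2) * (norm x)\<^sup>2"
    unfolding k2 using dot_norm_neg[of x y] by (simp add: power_mult_distrib)
  \<comment> \<open>The previous line says that the right side here is at most twice
    \<open>x \<bullet> y\<close>. Equality in this bound forces \<open>norm y = k * norm x\<close>,
    the radius of tangency.\<close>
  moreover have "2 * (k * norm x * norm y) \<le> (k * norm x)\<^sup>2 + (norm y)\<^sup>2"
    using sum_squares_bound[of "k * norm x" "norm y"] by (simp add: mult.assoc)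
  ultimately show ?thesis by (simp add: power_mult_distrib algebra_simps)
qed

lemma cone_ray_points:
  fixes x w :: "'a::euclidean_space"
  assumes r: "0 < r" "r \<le> 1" and k: "k = sqrt (1 - r\<^sup>2)" and w: "norm w = 1"
    and cone: "k * norm x \<le> x \<bullet> w"
  shows "(k * norm x) *\<^sub>R w \<in> cball x (r * norm x)"
    "(k * norm x) *\<^sub>R w \<in> cball (k *\<^sub>R x) (r * norm x)"
    "norm x *\<^sub>R w \<in> cball (k *\<^sub>R x) (r * norm x)"
proof -
  have k2: "k\<^sup>2 = 1 - r\<^sup>2" using r by (simp add: k power_le_one)
  have k01: "0 \<le> k" "k \<le> 1" using r by (auto simp: k power_le_one)
  have sq: "(norm (a *\<^sub>R x - b *\<^sub>R w))\<^sup>2 = a\<^sup>2 * (norm x)\<^sup>2 - 2 * a * b * (x \<bullet> w) + b\<^sup>2" for a b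
    using dot_norm_neg[of "a *\<^sub>R x" "b *\<^sub>R w"] w by (simp add: power_mult_distrib field_simps)
  \<comment> \<open>By the cone condition the squared distance is largest when
    \<open>x \<bullet> w = k * norm x\<close>. This leaves a polynomial inequality in
    \<open>k\<close>; it is an equality for the first and the third claim.\<close>
  have I: "b *\<^sub>R w \<in> cball (a *\<^sub>R x) (r * norm x)"
    if "a\<^sup>2 * (norm x)\<^sup>2 - 2 * a * b * (k * norm x) + b\<^sup>2 \<le> (1 - k\<^sup>2) * (norm x)\<^sup>2" "0 \<le> a" "0 \<le> b" for a b
  proof -
    have "2 * a * b * (k * norm x) \<le> 2 * a * b * (x \<bullet> w)" using that cone by (intro mult_left_mono) auto
    then have "(norm (a *\<^sub>R x - b *\<^sub>R w))\<^sup>2 \<le> (r * norm x)\<^sup>2"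
      using that k2 unfolding sq by (simp add: power_mult_distrib)
    then have "norm (a *\<^sub>R x - b *\<^sub>R w) \<le> r * norm x" using r by (simp add: power2_le_iff_abs_le)
    then show ?thesis by (simp add: dist_norm)
  qed
  show "(k * norm x) *\<^sub>R w \<in> cball x (r * norm x)"
    using I[of 1 "k * norm x"] k01 by (simp add: power2_eq_square algebra_simps)
  show "norm x *\<^sub>R w \<in> cball (k *\<^sub>R x) (r * norm x)"
    using I[of k "norm x"] k01 by (simp add: power2_eq_square algebra_simps)
  \<comment> \<open>For \<open>a = k\<close> and \<open>b = k * norm x\<close> the required
    inequality is \<open>2 * k^2 - 2 * k^3 \<le> 1 - k^2\<close>, and the difference of its sides
    factors in this way.\<close>
  have "(1 - k) * (1 - k) * (1 + 2 * k) * (norm x)\<^sup>2 \<ge> 0" using k01 by auto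
  moreover have "2 * k^3 = k * 2 * k\<^sup>2" by (simp add: power3_eq_cube power2_eq_square)
  ultimately show "(k * norm x) *\<^sub>R w \<in> cball (k *\<^sub>R x) (r * norm x)"
    using I[of k "k * norm x"] k01 by (simp add: power2_eq_square algebra_simps)
qed

subsection \<open>Radial measures\<close>

text \<open>Local integrability provides measurability of \<open>m t * t ^ k\<close> on each compact
  interval in the open half line. Dividing by \<open>t ^ k\<close> and exhausting the half line by
  such intervals recovers \<open>m\<close> as a pointwise limit.\<close>

lemma borel_measurable_radial_weight:
  fixes m :: "real \<Rightarrow> real"
  assumes "\<And>a b. 0 < a \<Longrightarrow> a \<le> b \<Longrightarrow> set_integrable lborel {a..b} (\<lambda>t. m t * t ^ k)"
  shows "(\<lambda>t. m t * indicator {0<..} t) \<in> borel_measurable borel"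
proof (rule borel_measurable_LIMSEQ_real)
  define u where "u i t = indicator {inverse (real (Suc i))..real (Suc i)} t * (m t * t ^ k) / t ^ k" for i t
  show "u i \<in> borel_measurable borel" for i
  proof -
    have "inverse (real (Suc i)) \<le> 1" "0 < inverse (real (Suc i))"
      by (auto simp: inverse_le_1_iff simp del: of_nat_Suc)
    then have "set_integrable lborel {inverse (real (Suc i))..real (Suc i)} (\<lambda>t. m t * t ^ k)"
      by (intro assms) auto
    then have [measurable]: "(\<lambda>t. indicator {inverse (real (Suc i))..real (Suc i)} t * (m t * t ^ k)) \<in> borel_measurable borel"
      unfolding set_integrable_def using borel_measurable_integrable by fastforce
    show ?thesis unfolding u_def by measurable
  qed
  show "(\<lambda>i. u i t) \<longlonglongrightarrow> m t * indicator {0<..} t" for t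
  proof (cases "t > 0")
    case True
    obtain N where N: "inverse (real (Suc N)) < t" using reals_Archimedean[OF True] by auto
    obtain M where M: "t \<le> real M" using real_arch_simple by blast
    have "u i t = m t * indicator {0<..} t" if "i \<ge> max N M" for i
    proof -
      have "inverse (real (Suc i)) \<le> inverse (real (Suc N))" using that by (intro le_imp_inverse_le) auto
      with N have "inverse (real (Suc i)) \<le> t" by linarith
      with M that True show ?thesis by (auto simp: u_def indicator_def simp del: of_nat_Suc)
    qed
    then show ?thesis
      by (intro tendsto_eventually eventually_sequentiallyI)
  next
    case False
    then have "\<not> inverse (real (Suc i)) \<le> t" for i
      using positive_imp_inverse_positive[of "real (Suc i)"] by linarith
    with False show ?thesis by (simp add: u_def indicator_def del: of_nat_Suc)
  qed
qed

text \<open>With \<open>n\<close> the dimension, this is the factor \<open>nu\<close> on the half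
  line in the polar decomposition of \<open>radial_measure m\<close>.\<close>

definition radial_part :: "(real \<Rightarrow> real) \<Rightarrow> nat \<Rightarrow> real measure" where
  "radial_part m n = density (radial_lborel n) (\<lambda>t. ennreal (m t))"

lemma sets_radial_part [simp, measurable_cong]: "sets (radial_part m n) = sets borel"
  by (simp add: radial_part_def)

lemma space_radial_part [simp]: "space (radial_part m n) = UNIV"
  by (simp add: radial_part_def)

lemma sets_radial_measure [simp, measurable_cong]: "sets (radial_measure m) = sets borel"
  by (simp add: radial_measure_def)

lemma space_radial_measure [simp]: "space (radial_measure m) = UNIV"
  by (simp add: radial_measure_def)

lemma AE_radial_part:
  assumes [measurable]: "m \<in> borel_measurable borel"
  shows "AE t in radial_part m n. t > 0"
proof -
  have [measurable]: "m \<in> borel_measurable (radial_lborel n)"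
    by (simp add: measurable_cong_sets[OF sets_radial_lborel refl])
  show ?thesis
    unfolding radial_part_def using AE_radial_lborel[of n]
    by (subst AE_density) (auto elim: eventually_mono)
qed

lemma AE_radial_measure_nonzero:
  assumes [measurable]: "m \<in> borel_measurable borel"
  shows "AE y in (radial_measure m :: 'a::euclidean_space measure). y \<noteq> 0"
  unfolding radial_measure_def using AE_lborel_singleton[of "0::'a"]
  by (subst AE_density) (auto elim: eventually_mono)

text \<open>In polar coordinates the weight \<open>m (norm (t *\<^sub>R w))\<close> equals
  \<open>m t\<close> for almost all \<open>w\<close> and \<open>t\<close>, so it can be absorbed
  into the radial factor.\<close>

lemma nn_integral_radial_measure:
  fixes h :: "'a::euclidean_space \<Rightarrow> ennreal"
  assumes [measurable]: "m \<in> borel_measurable borel" "h \<in> borel_measurable borel"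
  shows "(\<integral>\<^sup>+ y. h y \<partial>radial_measure m) =
    (\<integral>\<^sup>+ w. \<integral>\<^sup>+ t. h (t *\<^sub>R w) \<partial>radial_part m DIM('a) \<partial>sphere_measure)"
proof -
  have [measurable]: "m \<in> borel_measurable (radial_lborel DIM('a))"
    by (simp add: measurable_cong_sets[OF sets_radial_lborel refl])
  have "(\<integral>\<^sup>+ y. h y \<partial>radial_measure m) = (\<integral>\<^sup>+ y. ennreal (m (norm y)) * h y \<partial>lborel)"
    unfolding radial_measure_def by (subst nn_integral_density) auto
  also have "\<dots> = (\<integral>\<^sup>+ w. \<integral>\<^sup>+ t. ennreal (m (norm (t *\<^sub>R w))) * h (t *\<^sub>R w)
      \<partial>radial_lborel DIM('a) \<partial>sphere_measure)"
    by (rule nn_integral_polar) measurable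
  also have "\<dots> = (\<integral>\<^sup>+ w. \<integral>\<^sup>+ t. h (t *\<^sub>R w) \<partial>radial_part m DIM('a) \<partial>sphere_measure)"
  proof (rule nn_integral_cong_AE)
    show "AE w in (sphere_measure :: 'a measure).
        (\<integral>\<^sup>+ t. ennreal (m (norm (t *\<^sub>R w))) * h (t *\<^sub>R w) \<partial>radial_lborel DIM('a)) =
        (\<integral>\<^sup>+ t. h (t *\<^sub>R w) \<partial>radial_part m DIM('a))"
      using AE_sphere_measure
    proof eventually_elim
      case (elim w)
      have "(\<integral>\<^sup>+ t. ennreal (m (norm (t *\<^sub>R w))) * h (t *\<^sub>R w) \<partial>radial_lborel DIM('a)) =
          (\<integral>\<^sup>+ t. ennreal (m t) * h (t *\<^sub>R w) \<partial>radial_lborel DIM('a))"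
      proof (rule nn_integral_cong_AE)
        show "AE t in radial_lborel DIM('a). ennreal (m (norm (t *\<^sub>R w))) * h (t *\<^sub>R w) =
            ennreal (m t) * h (t *\<^sub>R w)"
          using AE_radial_lborel by eventually_elim (auto simp: elim)
      qed
      also have "\<dots> = (\<integral>\<^sup>+ t. h (t *\<^sub>R w) \<partial>radial_part m DIM('a))"
        unfolding radial_part_def by (subst nn_integral_density) auto
      finally show ?case .
    qed
  qed
  finally show ?thesis .
qed

lemma nn_integral_radial_measure_norm:
  fixes g :: "real \<Rightarrow> ennreal"
  assumes [measurable]: "m \<in> borel_measurable borel" "g \<in> borel_measurable borel"
  shows "(\<integral>\<^sup>+ y. g (norm y) \<partial>(radial_measure m :: 'a::euclidean_space measure)) =
    emeasure (sphere_measure :: 'a measure) UNIV * (\<integral>\<^sup>+ t. g t \<partial>radial_part m DIM('a))"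
proof -
  have "(\<integral>\<^sup>+ y. g (norm y) \<partial>(radial_measure m :: 'a measure)) =
      (\<integral>\<^sup>+ (w :: 'a). \<integral>\<^sup>+ t. g (norm (t *\<^sub>R w)) \<partial>radial_part m DIM('a) \<partial>sphere_measure)"
    by (rule nn_integral_radial_measure) measurable
  also have "\<dots> = (\<integral>\<^sup>+ (w :: 'a). \<integral>\<^sup>+ t. g t \<partial>radial_part m DIM('a) \<partial>sphere_measure)"
  proof (rule nn_integral_cong_AE)
    show "AE w in (sphere_measure :: 'a measure).
        (\<integral>\<^sup>+ t. g (norm (t *\<^sub>R w)) \<partial>radial_part m DIM('a)) = (\<integral>\<^sup>+ t. g t \<partial>radial_part m DIM('a))"
      using AE_sphere_measure
    proof eventually_elim
      case (elim w)
      show ?case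
      proof (rule nn_integral_cong_AE)
        show "AE t in radial_part m DIM('a). g (norm (t *\<^sub>R w)) = g t"
          using AE_radial_part[OF assms(1)] by eventually_elim (auto simp: elim)
      qed
    qed
  qed
  also have "\<dots> = emeasure (sphere_measure :: 'a measure) UNIV * (\<integral>\<^sup>+ t. g t \<partial>radial_part m DIM('a))"
    by (simp add: mult.commute)
  finally show ?thesis .
qed

lemma emeasure_radial_part_finite:
  assumes [measurable]: "m \<in> borel_measurable borel"
    and int: "\<And>a b. 0 < a \<Longrightarrow> a \<le> b \<Longrightarrow> set_integrable lborel {a..b} (\<lambda>t. m t * t ^ (n - 1))"
    and a: "0 < a"
  shows "emeasure (radial_part m n) {a..b} < \<infinity>"
proof (cases "a \<le> b")
  case True
  have [measurable]: "m \<in> borel_measurable (radial_lborel n)"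
    by (simp add: measurable_cong_sets[OF sets_radial_lborel refl])
  have "emeasure (radial_part m n) {a..b} = (\<integral>\<^sup>+ t. ennreal (m t) * indicator {a..b} t \<partial>radial_lborel n)"
    unfolding radial_part_def by (subst emeasure_density) auto
  also have "\<dots> = (\<integral>\<^sup>+ t. ennreal (real n * t ^ (n - 1)) * indicator {0<..} t *
      (ennreal (m t) * indicator {a..b} t) \<partial>lborel)"
    unfolding radial_lborel_def by (subst nn_integral_density) auto
  \<comment> \<open>\<open>m\<close> carries no sign condition here: \<open>ennreal\<close>
    truncates negative values to \<open>0\<close>, whereas the norm makes them positive, hence an
    inequality.\<close>
  also have "\<dots> \<le> (\<integral>\<^sup>+ t. ennreal (real n) * ennreal (norm (indicator {a..b} t *\<^sub>R (m t * t ^ (n - 1)))) \<partial>lborel)"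
    using a by (intro nn_integral_mono)
      (auto split: split_indicator simp: ennreal_mult'[symmetric] ennreal_mult''[symmetric] abs_mult
mult.assoc mult.commute[of "m _"]
        intro!: ennreal_leI mult_left_mono)
  also have "\<dots> = ennreal (real n) * (\<integral>\<^sup>+ t. ennreal (norm (indicator {a..b} t *\<^sub>R (m t * t ^ (n - 1)))) \<partial>lborel)"
    by (rule nn_integral_cmult) auto
  also have "\<dots> < \<infinity>"
    using int[OF a True] unfolding set_integrable_def integrable_iff_bounded
    by (auto simp: ennreal_mult_less_top)
  finally show ?thesis .
qed simp

section \<open>From balls to intervals of radii\<close>

text \<open>If every interval around \<open>s\<close> had average at most \<open>c\<close>, then so
  would every ray section of \<open>B\<close>, since such a section is empty or one of these
  intervals up to a null set. Integrating over directions would bound the average over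
  \<open>B\<close> by \<open>c\<close>.\<close>

lemma ex_ray_interval:
  fixes B :: "'a::euclidean_space set" and G :: "real \<Rightarrow> ennreal"
  assumes [measurable]: "m \<in> borel_measurable borel" "G \<in> borel_measurable borel" "B \<in> sets borel"
    and less: "c * emeasure (radial_measure m) B < (\<integral>\<^sup>+ y\<in>B. G (norm y) \<partial>radial_measure m)"
    and ray: "\<And>w. norm w = 1 \<Longrightarrow> (\<forall>t>0. t *\<^sub>R w \<notin> B) \<or>
      (\<exists>a b. 0 \<le> a \<and> a \<le> s \<and> s \<le> b \<and> (\<forall>t>0. t *\<^sub>R w \<in> B \<longleftrightarrow> a \<le> t \<and> t \<le> b))"
  shows "\<exists>a b. 0 \<le> a \<and> a \<le> s \<and> s \<le> b \<and>
    c * emeasure (radial_part m DIM('a)) {a..b} < (\<integral>\<^sup>+ t\<in>{a..b}. G t \<partial>radial_part m DIM('a))"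
proof (rule ccontr)
  let ?N = "radial_part m DIM('a)"
  assume "\<not> ?thesis"
  then have le: "(\<integral>\<^sup>+ t\<in>{a..b}. G t \<partial>?N) \<le> c * emeasure ?N {a..b}"
    if "0 \<le> a" "a \<le> s" "s \<le> b" for a b
    using that by (auto simp: not_less)
  have *: "(\<integral>\<^sup>+ t. G (norm (t *\<^sub>R w)) * indicator B (t *\<^sub>R w) \<partial>?N) \<le>
      c * (\<integral>\<^sup>+ t. indicator B (t *\<^sub>R w) \<partial>?N)" if w: "norm w = 1" for w
    using ray[OF w]
  proof (elim disjE exE conjE)
    assume empty: "\<forall>t>0. t *\<^sub>R w \<notin> B"
    have "(\<integral>\<^sup>+ t. G (norm (t *\<^sub>R w)) * indicator B (t *\<^sub>R w) \<partial>?N) = (\<integral>\<^sup>+ t. 0 \<partial>?N)"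
    proof (rule nn_integral_cong_AE)
      show "AE t in ?N. G (norm (t *\<^sub>R w)) * indicator B (t *\<^sub>R w) = 0"
        using AE_radial_part[OF assms(1)] by eventually_elim (use empty in auto)
    qed
    then show ?thesis by simp
  next
    fix a b assume ab: "0 \<le> a" "a \<le> s" "s \<le> b" and sec: "\<forall>t>0. t *\<^sub>R w \<in> B \<longleftrightarrow> a \<le> t \<and> t \<le> b"
    have "(\<integral>\<^sup>+ t. indicator B (t *\<^sub>R w) \<partial>?N) = (\<integral>\<^sup>+ t. indicator {a..b} t \<partial>?N)"
    proof (rule nn_integral_cong_AE)
      show "AE t in ?N. indicator B (t *\<^sub>R w) = (indicator {a..b} t :: ennreal)"
        using AE_radial_part[OF assms(1)] by eventually_elim (use sec in \<open>auto split: split_indicator\<close>)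
    qed
    moreover have "(\<integral>\<^sup>+ t. G (norm (t *\<^sub>R w)) * indicator B (t *\<^sub>R w) \<partial>?N) = (\<integral>\<^sup>+ t\<in>{a..b}. G t \<partial>?N)"
    proof (rule nn_integral_cong_AE)
      show "AE t in ?N. G (norm (t *\<^sub>R w)) * indicator B (t *\<^sub>R w) = G t * indicator {a..b} t"
        using AE_radial_part[OF assms(1)] by eventually_elim (use sec w in \<open>auto split: split_indicator\<close>)
    qed
    ultimately show ?thesis using le[OF ab] by simp
  qed
  have "(\<integral>\<^sup>+ y\<in>B. G (norm y) \<partial>radial_measure m) =
      (\<integral>\<^sup>+ w. \<integral>\<^sup>+ t. G (norm (t *\<^sub>R w)) * indicator B (t *\<^sub>R w) \<partial>?N \<partial>sphere_measure)"
    by (rule nn_integral_radial_measure) auto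
  also have "\<dots> \<le> (\<integral>\<^sup>+ w. \<integral>\<^sup>+ t. c * indicator B (t *\<^sub>R w) \<partial>?N \<partial>sphere_measure)"
  proof (rule nn_integral_mono_AE)
    show "AE w in sphere_measure. (\<integral>\<^sup>+ t. G (norm (t *\<^sub>R w)) * indicator B (t *\<^sub>R w) \<partial>?N) \<le>
        (\<integral>\<^sup>+ t. c * indicator B (t *\<^sub>R w) \<partial>?N)"
      using AE_sphere_measure
    proof eventually_elim
      case (elim w)
      then show ?case using *[OF elim] by (subst nn_integral_cmult) auto
    qed
  qed
  also have "\<dots> = (\<integral>\<^sup>+ y. c * indicator B y \<partial>radial_measure m)"
    by (rule nn_integral_radial_measure[symmetric]) auto
  also have "\<dots> = c * emeasure (radial_measure m) B"
    by (simp add: nn_integral_cmult_indicator)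
  finally show False using less by simp
qed

text \<open>For small balls, the cut by the cone loses nothing of \<open>cball x \<rho>\<close> and
  removes the rays on which the added ball alone would be met, possibly away from the radius
  \<open>norm x\<close>. Rays inside the cone meet both balls at the radius
  \<open>k * norm x\<close> and the added ball also at \<open>norm x\<close>.\<close>

lemma ball_enlargement:
  fixes x :: "'a::euclidean_space"
  assumes x: "x \<noteq> 0" and \<rho>: "0 < \<rho>"
    and doubling: "\<And>r. 0 < r \<Longrightarrow> r \<le> 1 \<Longrightarrow>
      emeasure (radial_measure m) (cball (sqrt (1 - r\<^sup>2) *\<^sub>R x) (r * norm x))
        \<le> C * emeasure (radial_measure m) (cball x (r * norm x))"
  obtains B where "B \<in> sets borel" "cball x \<rho> \<subseteq> B"
    "emeasure (radial_measure m) B \<le> (C + 1) * emeasure (radial_measure m) (cball x \<rho>)"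
    "\<And>w. norm w = 1 \<Longrightarrow> (\<forall>t>0. t *\<^sub>R w \<notin> B) \<or>
      (\<exists>a b. 0 \<le> a \<and> a \<le> norm x \<and> norm x \<le> b \<and> (\<forall>t>0. t *\<^sub>R w \<in> B \<longleftrightarrow> a \<le> t \<and> t \<le> b))"
proof -
  let ?mu = "emeasure (radial_measure m :: 'a measure)"
  have add: "?mu (cball x \<rho> \<union> B') \<le> (C + 1) * ?mu (cball x \<rho>)"
    if "?mu B' \<le> C * ?mu (cball x \<rho>)" "B' \<in> sets borel" for B'
  proof -
    have "?mu (cball x \<rho> \<union> B') \<le> ?mu (cball x \<rho>) + ?mu B'"
      using that by (intro emeasure_subadditive) auto
    also have "\<dots> \<le> ?mu (cball x \<rho>) + C * ?mu (cball x \<rho>)"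
      using that by (intro add_left_mono)
    finally show ?thesis by (simp add: distrib_right add.commute)
  qed
  show thesis
  proof (cases "\<rho> \<le> norm x")
    case True
    define r where "r = \<rho> / norm x"
    have r: "0 < r" "r \<le> 1" and \<rho>r: "\<rho> = r * norm x" using True x \<rho> by (auto simp: r_def)
    define k where "k = sqrt (1 - r\<^sup>2)"
    have k: "0 \<le> k" using r by (simp add: k_def power_le_one)
    define B where "B = (cball x \<rho> \<union> cball (k *\<^sub>R x) \<rho>) \<inter> {y. k * norm x * norm y \<le> x \<bullet> y}"
    have closed: "closed {y. k * norm x * norm y \<le> x \<bullet> y}"
      by (intro closed_Collect_le continuous_intros)
    show thesis
    proof (rule that[of B])
      show "B \<in> sets borel" unfolding B_def
        using closed by (intro borel_closed closed_Int closed_Un) auto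
      show "cball x \<rho> \<subseteq> B" unfolding B_def
        using cball_subset_cone[OF r k_def] unfolding \<rho>r by blast
      have "?mu B \<le> ?mu (cball x \<rho> \<union> cball (k *\<^sub>R x) \<rho>)"
        by (intro emeasure_mono) (auto simp: B_def)
      also have "\<dots> \<le> (C + 1) * ?mu (cball x \<rho>)"
        using doubling[OF r] by (intro add) (auto simp: k_def \<rho>r)
      finally show "?mu B \<le> (C + 1) * ?mu (cball x \<rho>)" .
      fix w :: 'a assume w: "norm w = 1"
      \<comment> \<open>The cone condition is homogeneous, so an open ray lies entirely inside or
        entirely outside.\<close>
      have cone: "k * norm x * norm (t *\<^sub>R w) \<le> x \<bullet> (t *\<^sub>R w) \<longleftrightarrow> k * norm x \<le> x \<bullet> w" if "t > 0" for t
        using that w by (simp add: mult.commute[of _ t])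
      show "(\<forall>t>0. t *\<^sub>R w \<notin> B) \<or>
        (\<exists>a b. 0 \<le> a \<and> a \<le> norm x \<and> norm x \<le> b \<and> (\<forall>t>0. t *\<^sub>R w \<in> B \<longleftrightarrow> a \<le> t \<and> t \<le> b))"
      proof (cases "k * norm x \<le> x \<bullet> w")
        case True
        have "\<exists>a b. 0 \<le> a \<and> a \<le> norm x \<and> norm x \<le> b \<and>
            (\<forall>t>0. t *\<^sub>R w \<in> cball x \<rho> \<union> cball (k *\<^sub>R x) \<rho> \<longleftrightarrow> a \<le> t \<and> t \<le> b)"
          using k x cone_ray_points[OF r k_def w True]
          by (intro two_cballs_ray_section[OF w, of "k * norm x"]) (auto simp: \<rho>r)
        moreover have "t *\<^sub>R w \<in> B \<longleftrightarrow> t *\<^sub>R w \<in> cball x \<rho> \<union> cball (k *\<^sub>R x) \<rho>" if "t > 0" for t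
          using cone[OF that] True unfolding B_def by blast
        ultimately show ?thesis by presburger
      next
        case False
        then show ?thesis using cone unfolding B_def by blast
      qed
    qed
  next
    case False
    show thesis
    proof (rule that[of "cball x \<rho> \<union> cball 0 (norm x)"])
      \<comment> \<open>At \<open>r = 1\<close> the shifted center is the origin.\<close>
      have "?mu (cball 0 (norm x)) \<le> C * ?mu (cball x (norm x))"
        using doubling[of 1] by simp
      also have "\<dots> \<le> C * ?mu (cball x \<rho>)"
        using False by (intro mult_left_mono emeasure_mono subset_cball) auto
      finally show "?mu (cball x \<rho> \<union> cball 0 (norm x)) \<le> (C + 1) * ?mu (cball x \<rho>)"
        by (intro add) auto
      fix w :: 'a assume w: "norm w = 1"
      show "(\<forall>t>0. t *\<^sub>R w \<notin> cball x \<rho> \<union> cball 0 (norm x)) \<or>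
        (\<exists>a b. 0 \<le> a \<and> a \<le> norm x \<and> norm x \<le> b \<and>
          (\<forall>t>0. t *\<^sub>R w \<in> cball x \<rho> \<union> cball 0 (norm x) \<longleftrightarrow> a \<le> t \<and> t \<le> b))"
        \<comment> \<open>The common point is the origin, which lies in
          \<open>cball x \<rho>\<close> because \<open>norm x < \<rho>\<close>.\<close>
        using two_cballs_ray_section[OF w, of 0 "norm x" x \<rho> 0 "norm x"] x w False by auto
    qed auto
  qed
qed

section \<open>The weak type inequality for radial functions\<close>

lemma ex_cball_of_maximal_op:
  assumes "lam < maximal_op mu f x"
  shows "\<exists>r>0. lam * emeasure mu (cball x r) < (\<integral>\<^sup>+ y\<in>cball x r. ennreal \<bar>f y\<bar> \<partial>mu)"
proof -
  obtain r where r: "r > 0" "0 < emeasure mu (cball x r)"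
    and less: "lam < (\<integral>\<^sup>+ y\<in>cball x r. ennreal \<bar>f y\<bar> \<partial>mu) / emeasure mu (cball x r)"
    using assms unfolding maximal_op_def by (auto simp: less_SUP_iff)
  have top: "emeasure mu (cball x r) \<noteq> top"
    using less by auto
  have "lam * emeasure mu (cball x r) < (\<integral>\<^sup>+ y\<in>cball x r. ennreal \<bar>f y\<bar> \<partial>mu)"
  proof (rule ccontr)
    assume "\<not> ?thesis"
    then have "(\<integral>\<^sup>+ y\<in>cball x r. ennreal \<bar>f y\<bar> \<partial>mu) / emeasure mu (cball x r) \<le> lam"
      using r by (intro divide_le_posI_ennreal) (auto simp: mult.commute)
    with less show False by simp
  qed
  with r show ?thesis by blast
qed

lemma outer_meas_le:
  assumes "A \<in> sets mu" "S \<subseteq> A"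
  shows "outer_meas mu S \<le> emeasure mu A"
  unfolding outer_meas_def using assms by (auto intro: INF_lower)

text \<open>The inequality for a weight that is Borel on the whole line; a general weight is brought
  to this form by cutting it off outside the open half line.\<close>

lemma weak_type_radial:
  fixes m :: "real \<Rightarrow> real" and C :: real and f :: "'a::euclidean_space \<Rightarrow> real" and lam :: real
  assumes m [measurable]: "m \<in> borel_measurable borel"
    and locint: "\<And>a b. 0 < a \<Longrightarrow> a \<le> b \<Longrightarrow>
      set_integrable lborel {a..b} (\<lambda>t. m t * t ^ (DIM('a) - 1))"
    and C: "C \<ge> 0"
    and doubling: "\<And>x r. 0 < r \<Longrightarrow> r \<le> 1 \<Longrightarrow>
      emeasure (radial_measure m :: 'a measure) (cball (sqrt (1 - r\<^sup>2) *\<^sub>R x) (r * norm x))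
        \<le> ennreal C * emeasure (radial_measure m) (cball x (r * norm x))"
    and radial: "radial_fun f" and f: "integrable (radial_measure m) f" and lam: "lam > 0"
  shows "ennreal lam * outer_meas (radial_measure m) {x. maximal_op (radial_measure m) f x > ennreal lam}
    \<le> ennreal (2 * (C + 1)) * (\<integral>\<^sup>+ x. ennreal \<bar>f x\<bar> \<partial>(radial_measure m))"
proof -
  let ?mu = "radial_measure m :: 'a measure"
  let ?nu = "radial_part m DIM('a)"
  let ?V = "emeasure (sphere_measure :: 'a measure) UNIV"
  obtain f0 where f0: "\<And>x. x \<noteq> 0 \<Longrightarrow> f x = f0 (norm x)"
    using radial unfolding radial_fun_def by blast
  have [measurable]: "f \<in> borel_measurable borel"
    using borel_measurable_integrable[OF f] by (simp add: measurable_cong_sets[OF sets_radial_measure refl])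
  obtain e :: 'a where e: "norm e = 1" using vector_choose_size[of 1] by auto
  \<comment> \<open>The profile \<open>f0\<close> need not be measurable, so the profile of the
    absolute value is read off along a fixed unit vector, where it inherits measurability from
    \<open>f\<close>.\<close>
  define G where "G t = ennreal \<bar>f (t *\<^sub>R e)\<bar>" for t
  have [measurable]: "G \<in> borel_measurable borel" unfolding G_def by measurable
  have G: "ennreal \<bar>f y\<bar> = G (norm y)" if "y \<noteq> 0" for y
  proof -
    have "norm y *\<^sub>R e \<noteq> 0" using that e by auto
    then show ?thesis using f0[OF that] f0[of "norm y *\<^sub>R e"] e by (simp add: G_def)
  qed
  have fG: "(\<integral>\<^sup>+ y\<in>A. ennreal \<bar>f y\<bar> \<partial>?mu) = (\<integral>\<^sup>+ y\<in>A. G (norm y) \<partial>?mu)" for A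
  proof (rule nn_integral_cong_AE)
    show "AE y in ?mu. ennreal \<bar>f y\<bar> * indicator A y = G (norm y) * indicator A y"
      using AE_radial_measure_nonzero[OF m] by eventually_elim (simp add: G)
  qed
  \<comment> \<open>The level is lowered by the factor \<open>C + 1\<close> that the enlargement of
    balls costs.\<close>
  define c where "c = ennreal (lam / (C + 1))"
  have c: "c < \<infinity>" "c * (ennreal C + 1) = ennreal lam"
    using C lam by (auto simp: c_def ennreal_mult'[symmetric] simp flip: ennreal_plus ennreal_1)
  define P where "P = {(a, b). c * emeasure ?nu {a<..<b} \<le> (\<integral>\<^sup>+ t\<in>{a<..<b}. G t \<partial>?nu)}"
  define E where "E = (\<Union>(a, b)\<in>P. {a<..<b})"
  have [measurable]: "E \<in> sets borel" unfolding E_def by (intro borel_open open_UN) auto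
  have nu0: "emeasure ?nu {..0} = 0"
    using AE_radial_part[OF m, of "DIM('a)"] by (subst (asm) AE_iff_measurable[of "{..0}"]) auto
  have level: "norm x \<in> E" if "x \<noteq> 0" and less: "ennreal lam < maximal_op ?mu f x" for x
  proof -
    obtain \<rho> where \<rho>: "\<rho> > 0" "ennreal lam * emeasure ?mu (cball x \<rho>) < (\<integral>\<^sup>+ y\<in>cball x \<rho>. ennreal \<bar>f y\<bar> \<partial>?mu)"
      using ex_cball_of_maximal_op[OF less] by blast
    obtain B where B [measurable]: "B \<in> sets borel" and sub: "cball x \<rho> \<subseteq> B"
      and mu: "emeasure ?mu B \<le> (ennreal C + 1) * emeasure ?mu (cball x \<rho>)"
      and ray: "\<And>w. norm w = 1 \<Longrightarrow> (\<forall>t>0. t *\<^sub>R w \<notin> B) \<or>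
        (\<exists>a b. 0 \<le> a \<and> a \<le> norm x \<and> norm x \<le> b \<and> (\<forall>t>0. t *\<^sub>R w \<in> B \<longleftrightarrow> a \<le> t \<and> t \<le> b))"
      using ball_enlargement[OF \<open>x \<noteq> 0\<close> \<rho>(1) doubling] by blast
    have "c * emeasure ?mu B \<le> c * ((ennreal C + 1) * emeasure ?mu (cball x \<rho>))"
      using mu by (intro mult_left_mono) auto
    also have "\<dots> = ennreal lam * emeasure ?mu (cball x \<rho>)"
      by (simp add: c(2) mult.assoc[symmetric])
    also have "\<dots> < (\<integral>\<^sup>+ y\<in>cball x \<rho>. ennreal \<bar>f y\<bar> \<partial>?mu)" by fact
    also have "\<dots> \<le> (\<integral>\<^sup>+ y\<in>B. ennreal \<bar>f y\<bar> \<partial>?mu)"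
      using sub by (intro nn_integral_mono) (auto split: split_indicator)
    finally have "c * emeasure ?mu B < (\<integral>\<^sup>+ y\<in>B. G (norm y) \<partial>?mu)" unfolding fG .
    from ex_ray_interval[OF m _ B this ray]
    obtain a b where ab: "0 \<le> a" "a \<le> norm x" "norm x \<le> b"
      and less': "c * emeasure ?nu {a..b} < (\<integral>\<^sup>+ t\<in>{a..b}. G t \<partial>?nu)" by auto
    \<comment> \<open>For \<open>a > 0\<close> the bound stays away from \<open>0\<close>, where
      local integrability gives finite mass; for \<open>a = 0\<close> the part added on the left
      lies in the null set \<open>{..0}\<close>.\<close>
    define p where "p = (if a = 0 then -1 else a / 2)"
    have pa: "p < a" using ab by (auto simp: p_def)
    text \<open>The weight need not be integrable at \<open>0\<close>; if \<open>a = 0\<close>, then the mass of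
      \<open>{a..b}\<close> is finite only because of the strict inequality \<open>less'\<close>.\<close>
    have fin: "emeasure ?nu {p<..<b + 1} < \<infinity>"
    proof (cases "a = 0")
      case False
      then have "emeasure ?nu {p<..<b + 1} \<le> emeasure ?nu {a / 2..b + 1}"
        by (intro emeasure_mono) (auto simp: p_def)
      also have "\<dots> < \<infinity>" using ab False by (intro emeasure_radial_part_finite m locint) auto
      finally show ?thesis .
    next
      case True
      have "c \<noteq> 0" using C lam by (auto simp: c_def)
      have "c * emeasure ?nu {0..b} < \<infinity>"
        using less' unfolding True by (rule order_less_le_trans) simp
      then have "emeasure ?nu {0..b} < \<infinity>"
        using \<open>c \<noteq> 0\<close> by (auto simp: ennreal_mult_less_top)
      moreover have "b > 0" using ab \<open>x \<noteq> 0\<close> by (meson order_less_le_trans zero_less_norm_iff)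
      then have "emeasure ?nu {b..b + 1} < \<infinity>" by (intro emeasure_radial_part_finite m locint) auto
      moreover have "emeasure ?nu {p<..<b + 1} \<le> emeasure ?nu ({..0} \<union> ({0..b} \<union> {b..b + 1}))"
        by (intro emeasure_mono) auto
      moreover have "\<dots> \<le> emeasure ?nu {..0} + (emeasure ?nu {0..b} + emeasure ?nu {b..b + 1})"
        by (intro order_trans[OF emeasure_subadditive] add_left_mono emeasure_subadditive) auto
      ultimately show ?thesis using nu0 by (simp add: order_le_less_trans)
    qed
    obtain a' b' where "a' < a" "b < b'" "c * emeasure ?nu {a'<..<b'} < (\<integral>\<^sup>+ t\<in>{a'<..<b'}. G t \<partial>?nu)"
      using enlarge_interval[OF _ c(1) pa _ fin less'] by auto
    then have "(a', b') \<in> P" "norm x \<in> {a'<..<b'}" using ab by (auto simp: P_def)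
    then show ?thesis unfolding E_def by blast
  qed
  \<comment> \<open>A Borel superset of the level set; the origin is added since
    \<open>level\<close> treats only nonzero points, and it has mass zero.\<close>
  let ?A = "{0} \<union> norm -` E"
  have [measurable]: "norm -` E \<in> sets (borel :: 'a measure)"
    using measurable_sets[of "norm :: 'a \<Rightarrow> real" borel borel E] by auto
  have "emeasure ?mu ?A = (\<integral>\<^sup>+ y. indicator E (norm y) \<partial>?mu)"
  proof -
    have "emeasure ?mu ?A = (\<integral>\<^sup>+ y. indicator ?A y \<partial>?mu)" by simp
    also have "\<dots> = (\<integral>\<^sup>+ y. indicator E (norm y) \<partial>?mu)"
    proof (rule nn_integral_cong_AE)
      show "AE y in ?mu. (indicator ?A y :: ennreal) = indicator E (norm y)"
        using AE_radial_measure_nonzero[OF m] by eventually_elim (auto split: split_indicator)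
    qed
    finally show ?thesis .
  qed
  also have "\<dots> = ?V * emeasure ?nu E"
    by (subst nn_integral_radial_measure_norm) auto
  finally have A: "emeasure ?mu ?A = ?V * emeasure ?nu E" .
  have "c * emeasure ?nu E \<le> 2 * (\<integral>\<^sup>+ t. G t \<partial>?nu)"
    unfolding E_def by (rule weak_type_intervals) (auto simp: P_def)
  then have "(ennreal C + 1) * (?V * (c * emeasure ?nu E)) \<le>
      (ennreal C + 1) * (?V * (2 * (\<integral>\<^sup>+ t. G t \<partial>?nu)))"
    by (intro mult_left_mono) auto
  then have "ennreal lam * emeasure ?mu ?A \<le> (2 * (ennreal C + 1)) * (?V * (\<integral>\<^sup>+ t. G t \<partial>?nu))"
    unfolding A c(2)[symmetric] by (simp add: algebra_simps)
  also have "?V * (\<integral>\<^sup>+ t. G t \<partial>?nu) = (\<integral>\<^sup>+ y. ennreal \<bar>f y\<bar> \<partial>?mu)"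
    using fG[of UNIV] by (subst nn_integral_radial_measure_norm[symmetric]) auto
  also have "2 * (ennreal C + 1) = ennreal (2 * (C + 1))"
    using C by (simp add: ennreal_mult)
  finally have *: "ennreal lam * emeasure ?mu ?A \<le> ennreal (2 * (C + 1)) * (\<integral>\<^sup>+ y. ennreal \<bar>f y\<bar> \<partial>?mu)" .
  have "outer_meas ?mu {x. maximal_op ?mu f x > ennreal lam} \<le> emeasure ?mu ?A"
    using level by (intro outer_meas_le) auto
  then show ?thesis
    by (intro order_trans[OF mult_left_mono *]) auto
qed

theorem theorem3p4:
  fixes mu0 :: "real \<Rightarrow> real" and C :: real
    and f :: "'a::euclidean_space \<Rightarrow> real" and lam :: real
  assumes mu0_nonneg: "\<And>t. t > 0 \<Longrightarrow> mu0 t \<ge> 0"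
    and mu0_nonzero: "\<not> (AE t in lborel. t > 0 \<longrightarrow> mu0 t = 0)"
    and mu0_locint: "\<And>a b. 0 < a \<Longrightarrow> a \<le> b \<Longrightarrow>
          set_integrable lborel {a..b} (\<lambda>t. mu0 t * t ^ (DIM('a) - 1))"
    and C_pos: "C > 0"
    and doubling: "\<And>x r. 0 < r \<Longrightarrow> r \<le> 1 \<Longrightarrow>
          emeasure (radial_measure mu0 :: 'a measure) (cball (sqrt (1 - r\<^sup>2) *\<^sub>R x) (r * norm x))
            \<le> ennreal C * emeasure (radial_measure mu0) (cball x (r * norm x))"
    and f_radial: "radial_fun f"
    and f_L1: "integrable (radial_measure mu0) f"
    and lam_pos: "lam > 0"
  shows "ennreal lam * outer_meas (radial_measure mu0)
            {x. maximal_op (radial_measure mu0) f x > ennreal lam}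
         \<le> ennreal (2 * (C + 1)) * (\<integral>\<^sup>+ x. ennreal \<bar>f x\<bar> \<partial>(radial_measure mu0))"
proof -
  \<comment> \<open>Nothing is known about \<open>mu0\<close> outside the open half line, where it
    may fail to be measurable.\<close>
  define m where "m t = mu0 t * indicator {0<..} t" for t
  have m [measurable]: "m \<in> borel_measurable borel"
    using borel_measurable_radial_weight[OF mu0_locint] unfolding m_def .
  have "set_integrable lborel {a..b} (\<lambda>t. m t * t ^ (DIM('a) - 1))" if "0 < a" "a \<le> b" for a b
    using mu0_locint[OF that]
    by (rule set_integrable_cong[THEN iffD1, rotated -1]) (use that in \<open>auto simp: m_def\<close>)
  moreover have "radial_measure mu0 = (radial_measure m :: 'a measure)"
  proof -
    \<comment> \<open>Composed with the norm, \<open>mu0\<close> and \<open>m\<close> can differ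
      only at the origin; this yields both the measurability of the original density and the
      equality of the two measures.\<close>
    have "(\<lambda>y::'a. mu0 (norm y)) = (\<lambda>y. if y = 0 then mu0 0 else m (norm y))"
      by (auto simp: m_def)
    moreover have "(\<lambda>y::'a. if y = 0 then mu0 0 else m (norm y)) \<in> borel_measurable borel"
      by measurable
    ultimately have "(\<lambda>y::'a. mu0 (norm y)) \<in> borel_measurable borel" by simp
    then show ?thesis
      unfolding radial_measure_def using AE_lborel_singleton[of "0::'a"]
      by (intro density_cong) (auto simp: m_def elim: eventually_mono)
  qed
  ultimately show ?thesis
    using weak_type_radial[OF m _ _ _ f_radial _ lam_pos, of C] C_pos doubling f_L1 by simp
qed

end
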